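(* Let $U,V$ be subspaces of $\mathbb{R}^n$ with $1\le p:=\dim U\le q:=\dim V\le n-1$, let $s:=\dim(U\cap V)$, assume $s<p$, and let $\theta_{s+1}$ be the $(s+1)$-th principal angle between $U$ and $V$ (which equals the Friedrichs angle $\theta_F$). For $\mu\in\mathbb{R}$ let $T_\mu:=(1-\mu)\mathrm{Id}+\mu P_UP_V$. Then $T_\mu$ is convergent if and only if $\mu\in[0,2)$. Moreover: (i) If $\mu\in\left(0,\frac{2}{1+\sin^2\theta_{s+1}}\right]$, then $T_\mu$ is convergent to $P_{U\cap V}$ with the optimal convergence rate $\gamma(T_\mu)=1-\mu\sin^2\theta_{s+1}$. (ii) If $\mu\in\left(\frac{2}{1+\sin^2\theta_{s+1}},2\right)$, then $T_\mu$ is convergent to $P_{U\cap V}$ with the optimal convergence rate $\gamma(T_\mu)=\mu-1$. Consequently, when $\mu\ne 0$, $T_\mu$ is convergent to $P_{U\cap V}$ with rate smaller than $\cos^2\theta_{s+1}$ if and only if $\mu\in(1,2-\sin^2\theta_{s+1})$. Furthermore, $T_\mu$ attains the smallest convergence rate $\frac{1-\sin^2\theta_{s+1}}{1+\sin^2\theta_{s+1}}$ at $\mu=\frac{2}{1+\sin^2\theta_{s+1}}$.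
   Context: $P_W$ denotes the orthogonal projection onto a subspace $W$ of $\mathbb{R}^n$. $\|\cdot\|$ is the operator norm; $\mathbb{N}=\{1,2,3,\dots\}$. A matrix $A$ is convergent to $A^\infty$ if $\|A^k-A^\infty\|\to0$ as $k\to\infty$. It is (linearly) convergent to $A^\infty$ with rate $\mu\in[0,1)$ if there are $M,N>0$ such that $\|A^k-A^\infty\|\le M\mu^k$ for all $k\in\mathbb{N}$, $k>N$; if the infimum of all such rates is itself a rate, it is called the optimal convergence rate. $\gamma(A):=\max\{|\lambda|:\lambda\in(\{0\}\cup\sigma(A))\setminus\{1\}\}$, where $\sigma(A)$ is the set of eigenvalues of $A$. Principal angles $\theta_1\le\dots\le\theta_p$ in $[0,\frac{\pi}{2}]$ between $U$ and $V$ are defined recursively by $\cos\theta_k:=\langle u_k,v_k\rangle=\max\{\langle u,v\rangle: u\in U, v\in V, \|u\|=\|v\|=1, \langle u,u_j\rangle=\langle v,v_j\rangle=0 \text{ for } j=1,\dots,k-1\}$, where $(u_k,v_k)$ is a maximizing pair; the angles do not depend on the choice of maximizers. The Friedrichs angle $\theta_F\in(0,\frac{\pi}{2}]$ is defined by $\cos\theta_F=c_F(U,V):=\max\{\langle u,v\rangle: u\in U\cap(U\cap V)^\perp, v\in V\cap(U\cap V)^\perp,\|u\|=\|v\|=1\}$. *)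

theory Defs
  imports "HOL-Analysis.Analysis"
begin

definition proj :: "(real^'n) set \<Rightarrow> real^'n \<Rightarrow> real^'n" where
  "proj W x = (THE y. y \<in> W \<and> x - y \<in> orthogonal_comp W)"

definition proj_mat :: "(real^'n) set \<Rightarrow> real^'n^'n" where
  "proj_mat W = matrix (proj W)"

(* The library's power operation on real^'n^'n is componentwise, so powers for the matrix
   product are introduced separately. *)
primrec matpow :: "'a::semiring_1^'n^'n \<Rightarrow> nat \<Rightarrow> 'a^'n^'n" where
  "matpow A 0 = mat 1"
| "matpow A (Suc k) = A ** matpow A k"

(* The library's norm on real^'n^'n is the Frobenius norm. *)
definition opnorm :: "real^'n^'n \<Rightarrow> real" where
  "opnorm A = onorm ((*v) A)"

definition convergent_to :: "real^'n^'n \<Rightarrow> real^'n^'n \<Rightarrow> bool" where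
  "convergent_to A L \<longleftrightarrow> (\<lambda>k. opnorm (matpow A k - L)) \<longlonglongrightarrow> 0"

definition convergent_mat :: "real^'n^'n \<Rightarrow> bool" where
  "convergent_mat A \<longleftrightarrow> (\<exists>L. convergent_to A L)"

definition convergent_with_rate :: "real^'n^'n \<Rightarrow> real^'n^'n \<Rightarrow> real \<Rightarrow> bool" where
  "convergent_with_rate A L r \<longleftrightarrow> 0 \<le> r \<and> r < 1 \<and>
     (\<exists>M N :: real. M > 0 \<and> N > 0 \<and> (\<forall>k::nat. real k > N \<longrightarrow> opnorm (matpow A k - L) \<le> M * r ^ k))"

definition optimal_rate :: "real^'n^'n \<Rightarrow> real^'n^'n \<Rightarrow> real \<Rightarrow> bool" where
  "optimal_rate A L r \<longleftrightarrow>
     convergent_with_rate A L r \<and> r = Inf {r'. convergent_with_rate A L r'}"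

(* Complex eigenvalues of the real matrix A. *)
definition spec :: "real^'n^'n \<Rightarrow> complex set" where
  "spec A = {z. \<exists>x :: complex^'n. x \<noteq> 0 \<and> map_matrix complex_of_real A *v x = z *s x}"

definition gamma_mat :: "real^'n^'n \<Rightarrow> real" where
  "gamma_mat A = Max (cmod ` (({0} \<union> spec A) - {1}))"

definition admissible_pair ::
  "(real^'n) set \<Rightarrow> (real^'n) set \<Rightarrow> (nat \<Rightarrow> real^'n) \<Rightarrow> (nat \<Rightarrow> real^'n) \<Rightarrow> nat \<Rightarrow> real^'n \<Rightarrow> real^'n \<Rightarrow> bool" where
  "admissible_pair U V u v k x y \<longleftrightarrow> x \<in> U \<and> y \<in> V \<and> norm x = 1 \<and> norm y = 1 \<and>
     (\<forall>j\<in>{1..<k}. x \<bullet> u j = 0 \<and> y \<bullet> v j = 0)"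

(* (u 1, v 1), ..., (u m, v m) are successive choices of maximizing pairs; the values of
   u and v outside {1..m} are irrelevant. *)
definition principal_vectors ::
  "(real^'n) set \<Rightarrow> (real^'n) set \<Rightarrow> nat \<Rightarrow> (nat \<Rightarrow> real^'n) \<Rightarrow> (nat \<Rightarrow> real^'n) \<Rightarrow> bool" where
  "principal_vectors U V m u v \<longleftrightarrow>
     (\<forall>k\<in>{1..m}. admissible_pair U V u v k (u k) (v k) \<and>
        (\<forall>x y. admissible_pair U V u v k x y \<longrightarrow> x \<bullet> y \<le> u k \<bullet> v k))"

(* THE: the k-th angle does not depend on the choice of the maximizing pairs. *)
definition principal_angle :: "(real^'n) set \<Rightarrow> (real^'n) set \<Rightarrow> nat \<Rightarrow> real" where
  "principal_angle U V k = (THE \<theta>. 0 \<le> \<theta> \<and> \<theta> \<le> pi / 2 \<and>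
     (\<exists>u v. principal_vectors U V k u v \<and> cos \<theta> = u k \<bullet> v k))"

definition friedrichs_cos :: "(real^'n) set \<Rightarrow> (real^'n) set \<Rightarrow> real" where
  "friedrichs_cos U V = (GREATEST c. \<exists>u v.
     u \<in> U \<inter> orthogonal_comp (U \<inter> V) \<and> v \<in> V \<inter> orthogonal_comp (U \<inter> V) \<and>
     norm u = 1 \<and> norm v = 1 \<and> c = u \<bullet> v)"

definition friedrichs_angle :: "(real^'n) set \<Rightarrow> (real^'n) set \<Rightarrow> real" where
  "friedrichs_angle U V = (THE \<theta>. 0 < \<theta> \<and> \<theta> \<le> pi / 2 \<and> cos \<theta> = friedrichs_cos U V)"

definition relaxed_proj :: "(real^'n) set \<Rightarrow> (real^'n) set \<Rightarrow> real \<Rightarrow> real^'n^'n" where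
  "relaxed_proj U V \<mu> = (1 - \<mu>) *\<^sub>R mat 1 + \<mu> *\<^sub>R (proj_mat U ** proj_mat V)"

end

theory Submission
  imports Defs
begin

text \<open>
  Write \<open>W = U \<inter> V\<close> and let \<open>c\<close> be the cosine of the Friedrichs angle. The family
  \<open>T \<mu> = (1 - \<mu>) Id + \<mu> P\<^sub>U P\<^sub>V\<close> is understood without diagonalizing it, through three
  observations.

  \<^item> \<^emph>\<open>Upper bound.\<close> On \<open>U\<close> the operator \<open>P\<^sub>U P\<^sub>V\<close> is self-adjoint with quadratic form
    \<open>\<parallel>P\<^sub>V x\<parallel>\<^sup>2\<close>, which on \<open>U \<inter> W\<^sup>\<bottom>\<close> lies between \<open>0\<close> and \<open>c\<^sup>2 \<parallel>x\<parallel>\<^sup>2\<close>. So the form of \<open>T \<mu>\<close> there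
    lies between \<open>1 - \<mu>\<close> and \<open>1 - \<mu> (1 - c\<^sup>2)\<close> when \<open>\<mu> \<ge> 0\<close>, and the norm of the operator there is at most
    \<open>\<rho> = max (1 - \<mu> (1 - c\<^sup>2)) (\<mu> - 1)\<close>. On \<open>W\<close> it is the identity and on the kernel of \<open>P\<^sub>U P\<^sub>V\<close> it is
    multiplication by \<open>1 - \<mu>\<close>. Every vector is a sum of a vector of \<open>U\<close> and a vector of that
    kernel (\<open>ex_U_component\<close>), so for \<open>0 < \<mu> < 2\<close>, where \<open>\<rho> < 1\<close>, the factor \<open>\<rho>\<close> is a rate of
    convergence to the projection onto \<open>W\<close> (\<open>T_convergent_with_rate\<close>).

  \<^item> \<^emph>\<open>Lower bound.\<close> If the powers of a matrix converge, each eigenvalue is \<open>1\<close> or lies inside the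
    unit disc, and in the second case its modulus is at most any rate (\<open>spec_le_rate\<close>). The number
    \<open>1 - \<mu>\<close> is an eigenvalue because \<open>V\<close> is a proper subspace, and \<open>1 - \<mu> (1 - c\<^sup>2)\<close> is one because
    a pair \<open>u, v\<close> realizing \<open>c\<close> satisfies \<open>P\<^sub>V u = c v\<close> and \<open>P\<^sub>U v = c u\<close>. For
    \<open>0 < \<mu> < 2\<close> one of the two has modulus \<open>\<rho>\<close>, which makes \<open>\<rho>\<close> both the optimal rate and \<open>\<gamma>\<close>. Outside
    \<open>[0, 2)\<close> the eigenvalue \<open>1 - \<mu>\<close> prevents convergence.

  \<^item> \<^emph>\<open>The angle.\<close> As long as a unit vector of \<open>W\<close> orthogonal to the earlier choices remains, a
    maximizing pair has inner product \<open>1\<close>, so its two members coincide. Hence the first \<open>dim W\<close>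
    principal vectors form an orthonormal basis of \<open>W\<close>, and the next maximization is the one that
    defines \<open>c\<close> (\<open>principal_angle_eq\<close>).

  What remains is the study of the maximum of two affine functions of \<open>\<mu>\<close>, one decreasing and
  one increasing, which cross at \<open>\<mu> = 2 / (1 + (1 - c\<^sup>2))\<close>.
\<close>

section \<open>Orthogonal projections and inner products\<close>

lemma proj_eqI:
  assumes W: "subspace W" and y: "y \<in> W" and orth: "\<And>w. w \<in> W \<Longrightarrow> y \<bullet> w = x \<bullet> w"
  shows "proj W x = y"
  unfolding proj_def
proof (rule the_equality)
  show "y \<in> W \<and> x - y \<in> orthogonal_comp W"
    using y orth by (auto simp: orthogonal_comp_def orthogonal_def inner_diff_right inner_commute)
next
  fix y' assume y': "y' \<in> W \<and> x - y' \<in> orthogonal_comp W"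
  have "y' - y \<in> W"
    using W y y' by (simp add: subspace_diff)
  then have "y \<bullet> (y' - y) = x \<bullet> (y' - y)" and "(y' - y) \<bullet> (x - y') = 0"
    using orth y' by (simp_all add: orthogonal_comp_def orthogonal_def)
  then have "(y' - y) \<bullet> (y' - y) = 0"
    by (simp add: inner_diff_left inner_diff_right inner_commute)
  then show "y' = y" by simp
qed

lemma
  assumes W: "subspace W"
  shows proj_in: "proj W x \<in> W"
    and inner_proj: "w \<in> W \<Longrightarrow> proj W x \<bullet> w = x \<bullet> w"
proof -
  obtain y z where "y \<in> span W" and z: "\<And>w. w \<in> span W \<Longrightarrow> orthogonal z w" and x: "x = y + z"
    using orthogonal_subspace_decomp_exists by blast
  then have orth: "y \<bullet> w = x \<bullet> w" if "w \<in> W" for w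
    using W that by (auto simp: orthogonal_def inner_add_left span_base)
  have "y \<in> W"
    using \<open>y \<in> span W\<close> W by (metis span_eq_iff)
  with proj_eqI[OF W] orth have "proj W x = y"
    by blast
  then show "proj W x \<in> W" "w \<in> W \<Longrightarrow> proj W x \<bullet> w = x \<bullet> w"
    using \<open>y \<in> W\<close> orth by auto
qed

lemma proj_ident: "subspace W \<Longrightarrow> x \<in> W \<Longrightarrow> proj W x = x"
  by (simp add: proj_eqI)

lemma proj_eq_0: "subspace W \<Longrightarrow> (\<And>w. w \<in> W \<Longrightarrow> x \<bullet> w = 0) \<Longrightarrow> proj W x = 0"
  by (simp add: proj_eqI subspace_0)

lemma proj_selfadjoint:
  assumes "subspace W"
  shows "proj W x \<bullet> y = x \<bullet> proj W y"
  using inner_proj[OF assms proj_in[OF assms], of x y] inner_proj[OF assms proj_in[OF assms], of y x]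
  by (simp add: inner_commute)

lemma inner_proj_self:
  assumes "subspace W"
  shows "x \<bullet> proj W x = (norm (proj W x))\<^sup>2"
  using inner_proj[OF assms proj_in[OF assms], of x x] by (simp add: dot_square_norm)

lemma linear_proj:
  assumes "subspace W"
  shows "linear (proj W)"
proof (rule linearI)
  show "proj W (x + y) = proj W x + proj W y" for x y
    by (rule proj_eqI[OF assms])
      (simp_all add: assms subspace_add proj_in inner_proj inner_add_left)
  show "proj W (r *\<^sub>R x) = r *\<^sub>R proj W x" for r x
    by (rule proj_eqI[OF assms]) (simp_all add: assms subspace_scale proj_in inner_proj)
qed

lemma proj_mat_mult: "subspace W \<Longrightarrow> proj_mat W *v x = proj W x"
  by (simp add: proj_mat_def matrix_works linear_matrix_vector_mul_eq linear_proj)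

lemma exists_unit_orthogonal:
  fixes S T :: "'a::euclidean_space set"
  assumes S: "subspace S" and "T \<subseteq> S" and dim: "dim T < dim S"
  obtains x where "x \<in> S" "norm x = 1" "\<And>t. t \<in> T \<Longrightarrow> x \<bullet> t = 0"
proof -
  have "span T \<subset> span S"
    using assms by (metis dim_span nless_le psubsetI span_mono)
  then obtain x where "x \<noteq> 0" "x \<in> span S" and x: "\<And>t. t \<in> span T \<Longrightarrow> orthogonal x t"
    using orthogonal_to_subspace_exists_gen by blast
  then show thesis
    using that[of "x /\<^sub>R norm x"] S by (simp add: orthogonal_def span_base span_eq_iff[THEN iffD2] subspace_scale)
qed

lemma orthonormal_family_spans:
  fixes u :: "nat \<Rightarrow> 'a::euclidean_space"
  assumes S: "subspace S" and m: "m = dim S"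
    and u: "\<And>k. k \<in> {1..m} \<Longrightarrow> u k \<in> S \<and> norm (u k) = 1"
    and orth: "\<And>j k. j \<in> {1..m} \<Longrightarrow> k \<in> {1..m} \<Longrightarrow> j < k \<Longrightarrow> u k \<bullet> u j = 0"
  shows "S = span (u ` {1..m})"
proof -
  have orth': "u j \<bullet> u k = 0" if "j \<in> {1..m}" "k \<in> {1..m}" "j \<noteq> k" for j k
    using that orth[of j k] orth[of k j] by (cases "j < k") (auto simp: inner_commute)
  have "inj_on u {1..m}"
  proof (rule inj_onI, rule ccontr)
    fix j k assume jk: "j \<in> {1..m}" "k \<in> {1..m}" "u j = u k" "j \<noteq> k"
    then have "u j \<bullet> u j = 0"
      using orth'[of j k] by simp
    with u[of j] jk show False by simp
  qed
  then have card: "card (u ` {1..m}) = dim S"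
    by (simp add: card_image m)
  have "pairwise orthogonal (u ` {1..m})"
    unfolding pairwise_def orthogonal_def using orth' by (force simp del: atLeastAtMost_iff)
  moreover have "0 \<notin> u ` {1..m}"
    using u by force
  ultimately have "independent (u ` {1..m})"
    by (rule pairwise_orthogonal_independent)
  then have "S \<subseteq> span (u ` {1..m})"
    using u card by (intro card_ge_dim_independent) auto
  moreover have "span (u ` {1..m}) \<subseteq> S"
    using u S by (intro span_minimal) auto
  ultimately show ?thesis by blast
qed

lemma inner_eq_0_span:
  "(\<And>t. t \<in> T \<Longrightarrow> x \<bullet> t = 0) \<Longrightarrow> w \<in> span T \<Longrightarrow> x \<bullet> w = 0"
  using orthogonal_to_span[of w T x] by (auto simp: orthogonal_def inner_commute)

lemma unit_inner_le:
  assumes bound: "\<And>x y. x \<in> X \<Longrightarrow> y \<in> Y \<Longrightarrow> norm x = 1 \<Longrightarrow> norm y = 1 \<Longrightarrow> x \<bullet> y \<le> c"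
    and "subspace X" "subspace Y" "x \<in> X" "y \<in> Y"
  shows "x \<bullet> y \<le> c * norm x * norm y"
proof (cases "x = 0 \<or> y = 0")
  case False
  then have "(x /\<^sub>R norm x) \<bullet> (y /\<^sub>R norm y) \<le> c"
    using assms by (intro bound) (auto simp: subspace_scale)
  with False show ?thesis
    by (simp add: field_simps)
qed auto

lemma unit_inner_le_1:
  fixes x y :: "'a::real_inner"
  shows "norm x = 1 \<Longrightarrow> norm y = 1 \<Longrightarrow> x \<bullet> y \<le> 1"
  using norm_cauchy_schwarz[of x y] by simp

text \<open>The equality case of the Cauchy-Schwarz inequality for unit vectors.\<close>

lemma unit_inner_eq_1D:
  fixes x y :: "'a::real_inner"
  assumes "norm x = 1" "norm y = 1" "x \<bullet> y = 1"
  shows "x = y"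
proof -
  have "(x - y) \<bullet> (x - y) = 0"
    unfolding inner_diff_left inner_diff_right
    using assms by (simp add: inner_commute[of y x] dot_square_norm)
  then show ?thesis by simp
qed

lemma parallelogram_law:
  fixes x y :: "'a::real_inner"
  shows "(norm (x + y))\<^sup>2 + (norm (x - y))\<^sup>2 = 2 * (norm x)\<^sup>2 + 2 * (norm y)\<^sup>2"
  by (simp add: power2_norm_eq_inner inner_add_left inner_add_right inner_diff_left inner_diff_right)

text \<open>
  The norm of a self-adjoint operator is governed by its quadratic form, by polarization:
  \<open>4 \<langle>f x, y\<rangle>\<close> is the difference of the forms at \<open>x + y\<close> and \<open>x - y\<close>. The restriction to an
  invariant subspace is there because a product of two projections is self-adjoint on the range of
  the left factor but in general not on the whole space.
\<close>

lemma selfadjoint_norm_le: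
  fixes f :: "'a::real_inner \<Rightarrow> 'a"
  assumes lin: "linear f" and X: "subspace X"
    and fX: "\<And>x. x \<in> X \<Longrightarrow> f x \<in> X"
    and sym: "\<And>x y. x \<in> X \<Longrightarrow> y \<in> X \<Longrightarrow> f x \<bullet> y = x \<bullet> f y"
    and form: "\<And>x. x \<in> X \<Longrightarrow> \<bar>f x \<bullet> x\<bar> \<le> g * (norm x)\<^sup>2"
    and x: "x \<in> X"
  shows "norm (f x) \<le> g * norm x"
proof (cases "f x = 0 \<or> x = 0")
  case True
  have "0 \<le> g * norm x" if "x \<noteq> 0"
  proof -
    have "0 \<le> g * (norm x)\<^sup>2"
      using form[OF x] by linarith
    then show ?thesis
      using that by (simp add: zero_le_mult_iff)
  qed
  with True show ?thesis
    using linear_0[OF lin] by (cases "x = 0") auto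
next
  case False
  \<comment> \<open>Rescaling \<open>f x\<close> to the norm of \<open>x\<close> gives both norms equal weight in the parallelogram law.\<close>
  define y where "y = (norm x / norm (f x)) *\<^sub>R f x"
  have y: "y \<in> X" "norm y = norm x"
    using False x by (auto simp: y_def fX X subspace_scale)
  have "4 * (f x \<bullet> y) = f (x + y) \<bullet> (x + y) - f (x - y) \<bullet> (x - y)"
    using sym[OF x y(1)]
    by (simp add: linear_add[OF lin] linear_diff[OF lin] inner_add_left inner_add_right
        inner_diff_left inner_diff_right inner_commute)
  also have "\<dots> \<le> g * (norm (x + y))\<^sup>2 + g * (norm (x - y))\<^sup>2"
    using form[of "x + y"] form[of "x - y"] x y X by (simp add: subspace_add subspace_diff abs_le_iff)
  also have "\<dots> = g * (2 * (norm x)\<^sup>2 + 2 * (norm y)\<^sup>2)"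
    by (simp only: distrib_left[symmetric] parallelogram_law)
  also have "\<dots> = g * (4 * (norm x)\<^sup>2)"
    by (simp add: y(2))
  finally have "f x \<bullet> y \<le> g * (norm x)\<^sup>2"
    by simp
  moreover have "f x \<bullet> y = norm x * norm (f x)"
    using False by (simp add: y_def dot_square_norm power2_eq_square)
  ultimately show ?thesis
    using False by (simp add: power2_eq_square)
qed

section \<open>The Friedrichs angle\<close>

text \<open>
  Neither subspace contains the other, which is what makes the maximum in the definition of the
  Friedrichs angle range over a nonempty set.
\<close>

locale subspace_pair =
  fixes U V :: "(real^'n) set"
  assumes U: "subspace U" and V: "subspace V"
    and dim_U: "dim (U \<inter> V) < dim U" and dim_V: "dim (U \<inter> V) < dim V"
begin

abbreviation "W \<equiv> U \<inter> V"
abbreviation "c \<equiv> friedrichs_cos U V"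

lemma W: "subspace W"
  using U V by (rule subspace_inter)

definition "U' = {x \<in> U. \<forall>w \<in> W. x \<bullet> w = 0}"
definition "V' = {x \<in> V. \<forall>w \<in> W. x \<bullet> w = 0}"

lemma U'_eq: "U' = U \<inter> orthogonal_comp W" and V'_eq: "V' = V \<inter> orthogonal_comp W"
  by (auto simp: U'_def V'_def orthogonal_comp_def orthogonal_def inner_commute)

lemma subspace_U': "subspace U'" and subspace_V': "subspace V'"
  unfolding U'_eq V'_eq by (intro subspace_inter U V subspace_orthogonal_comp)+

lemma U'_Int_V': "x \<in> U' \<Longrightarrow> x \<in> V' \<Longrightarrow> x = 0"
  using inner_eq_zero_iff[of x] by (auto simp: U'_def V'_def)

lemma ex_maximizing_pair:
  "\<exists>u v. u \<in> U' \<and> v \<in> V' \<and> norm u = 1 \<and> norm v = 1 \<and>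
    (\<forall>x\<in>U'. \<forall>y\<in>V'. norm x = 1 \<longrightarrow> norm y = 1 \<longrightarrow> x \<bullet> y \<le> u \<bullet> v)"
proof -
  let ?S = "(U' \<inter> sphere 0 1) \<times> (V' \<inter> sphere 0 1)"
  obtain u0 where "u0 \<in> U" "norm u0 = 1" "\<And>t. t \<in> W \<Longrightarrow> u0 \<bullet> t = 0"
    using exists_unit_orthogonal[OF U _ dim_U] by auto
  moreover obtain v0 where "v0 \<in> V" "norm v0 = 1" "\<And>t. t \<in> W \<Longrightarrow> v0 \<bullet> t = 0"
    using exists_unit_orthogonal[OF V _ dim_V] by auto
  ultimately have "(u0, v0) \<in> ?S"
    by (auto simp: U'_def V'_def)
  moreover have "compact ?S"
    by (intro compact_Times closed_Int_compact closed_subspace subspace_U' subspace_V' compact_sphere)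
  moreover have "continuous_on ?S (\<lambda>z. fst z \<bullet> snd z)"
    by (intro continuous_intros)
  ultimately obtain z where "z \<in> ?S" "\<forall>y\<in>?S. fst y \<bullet> snd y \<le> fst z \<bullet> snd z"
    using continuous_attains_sup[of ?S "\<lambda>z. fst z \<bullet> snd z"] by blast
  then show ?thesis
    by (intro exI[of _ "fst z"] exI[of _ "snd z"]) (auto simp: dist_norm)
qed

lemma friedrichs_cos_eqI:
  assumes "u \<in> U'" "v \<in> V'" "norm u = 1" "norm v = 1"
    and "\<And>x y. x \<in> U' \<Longrightarrow> y \<in> V' \<Longrightarrow> norm x = 1 \<Longrightarrow> norm y = 1 \<Longrightarrow> x \<bullet> y \<le> u \<bullet> v"
  shows "c = u \<bullet> v"
  unfolding friedrichs_cos_def U'_eq[symmetric] V'_eq[symmetric]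
  by (rule Greatest_equality) (use assms in auto)

lemma friedrichs_pair:
  obtains u v where "u \<in> U'" "v \<in> V'" "norm u = 1" "norm v = 1" "c = u \<bullet> v"
  using ex_maximizing_pair friedrichs_cos_eqI by metis

lemma inner_le_c_unit: "x \<in> U' \<Longrightarrow> y \<in> V' \<Longrightarrow> norm x = 1 \<Longrightarrow> norm y = 1 \<Longrightarrow> x \<bullet> y \<le> c"
  using ex_maximizing_pair friedrichs_cos_eqI by metis

lemma inner_le_c: "x \<in> U' \<Longrightarrow> y \<in> V' \<Longrightarrow> x \<bullet> y \<le> c * norm x * norm y"
  using inner_le_c_unit subspace_U' subspace_V' by (rule unit_inner_le)

lemma c_nonneg: "0 \<le> c"
proof -
  obtain u v where uv: "u \<in> U'" "v \<in> V'" "norm u = 1" "norm v = 1" "c = u \<bullet> v"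
    by (rule friedrichs_pair)
  then have "- u \<bullet> v \<le> c"
    by (intro inner_le_c_unit subspace_neg subspace_U') auto
  with uv show ?thesis by simp
qed

lemma c_less_1: "c < 1"
proof -
  obtain u v where uv: "u \<in> U'" "v \<in> V'" "norm u = 1" "norm v = 1" "c = u \<bullet> v"
    by (rule friedrichs_pair)
  have "u \<bullet> v \<noteq> 1"
  proof
    assume "u \<bullet> v = 1"
    with uv have "u = v"
      by (metis unit_inner_eq_1D)
    with uv U'_Int_V' show False by force
  qed
  moreover have "u \<bullet> v \<le> 1"
    using unit_inner_le_1 uv by blast
  ultimately show ?thesis
    using uv by simp
qed

lemma friedrichs_angle_eq: "friedrichs_angle U V = arccos c"
  unfolding friedrichs_angle_def
proof (rule the_equality)
  have "arccos c \<noteq> 0"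
    using c_less_1 c_nonneg cos_arccos[of c] cos_zero by fastforce
  moreover have "0 \<le> arccos c" "arccos c \<le> pi / 2"
    using c_less_1 c_nonneg arccos_lbound[of c] arccos_le_pi2[of c] by linarith+
  ultimately show "0 < arccos c \<and> arccos c \<le> pi / 2 \<and> cos (arccos c) = c"
    using c_less_1 c_nonneg by simp
next
  fix t assume "0 < t \<and> t \<le> pi / 2 \<and> cos t = c"
  then show "t = arccos c"
    using arccos_cos[of t] by auto
qed

section \<open>Principal vectors\<close>

text \<open>
  The vectors chosen before step \<open>k \<le> dim W\<close> cannot exhaust \<open>W\<close>. Any unit vector \<open>w \<in> W\<close> orthogonal to
  them competes as the pair \<open>(w, w)\<close> with value \<open>1\<close>, because by induction both earlier families agree
  and so impose the same constraint on both members of the pair.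
\<close>

lemma principal_vectors_in_W:
  assumes pv: "principal_vectors U V m u v" and k: "k \<in> {1..m}" "k \<le> dim W"
  shows "u k = v k \<and> u k \<in> W"
  using k
proof (induction k rule: less_induct)
  case (less k)
  let ?T = "u ` {1..<k}"
  have T: "?T \<subseteq> W"
    using less.IH less.prems by fastforce
  have "dim ?T \<le> card ?T"
    by (simp add: dim_le_card')
  also have "\<dots> < dim W"
    using less.prems card_image_le[of "{1..<k}" u] by auto
  finally obtain w where w: "w \<in> W" "norm w = 1" "\<And>t. t \<in> ?T \<Longrightarrow> w \<bullet> t = 0"
    using exists_unit_orthogonal[OF W T] by auto
  have "v j = u j" if "j \<in> {1..<k}" for j
    using less that by auto
  then have "admissible_pair U V u v k w w"
    using w by (auto simp: admissible_pair_def)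
  moreover have adm: "admissible_pair U V u v k (u k) (v k)"
    and max: "\<And>x y. admissible_pair U V u v k x y \<Longrightarrow> x \<bullet> y \<le> u k \<bullet> v k"
    using pv less.prems by (auto simp: principal_vectors_def)
  ultimately have "1 \<le> u k \<bullet> v k"
    using w(2) by (metis dot_square_norm one_power2)
  moreover have "norm (u k) = 1" "norm (v k) = 1"
    using adm by (auto simp: admissible_pair_def)
  ultimately have "u k = v k"
    by (metis unit_inner_eq_1D unit_inner_le_1 order_antisym)
  with adm show ?case
    by (auto simp: admissible_pair_def)
qed

text \<open>
  Once the chosen vectors span \<open>W\<close>, the constraints of the next step are those of the Friedrichs angle.
\<close>

lemma admissible_pair_iff:
  assumes "W = span (u ` {1..dim W})" "\<And>k. k \<in> {1..dim W} \<Longrightarrow> v k = u k"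
  shows "admissible_pair U V u v (dim W + 1) x y \<longleftrightarrow> x \<in> U' \<and> y \<in> V' \<and> norm x = 1 \<and> norm y = 1"
proof -
  have *: "(\<forall>j\<in>{1..<dim W + 1}. x \<bullet> u j = 0) \<longleftrightarrow> (\<forall>w\<in>W. x \<bullet> w = 0)" (is "?L x \<longleftrightarrow> ?R x") for x
  proof
    assume "?L x"
    then have "x \<bullet> t = 0" if "t \<in> u ` {1..dim W}" for t
      using that by auto
    then show "?R x"
      using inner_eq_0_span[of "u ` {1..dim W}" x] assms(1) by blast
  next
    assume R: "?R x"
    have "u j \<in> W" if "j \<in> {1..<dim W + 1}" for j
      by (subst assms(1)) (use that in \<open>auto intro: span_base\<close>)
    with R show "?L x" by blast
  qed
  have "(\<forall>j\<in>{1..<dim W + 1}. x \<bullet> u j = 0 \<and> y \<bullet> v j = 0) \<longleftrightarrow> ?L x \<and> ?L y"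
    using assms(2) by auto
  then show ?thesis
    unfolding admissible_pair_def * U'_def V'_def by blast
qed

lemma principal_vectors_inner:
  assumes pv: "principal_vectors U V (dim W + 1) u v"
  shows "u (dim W + 1) \<bullet> v (dim W + 1) = c"
proof -
  have eq: "v k = u k" "u k \<in> W" if "k \<in> {1..dim W}" for k
    using principal_vectors_in_W[OF pv, of k] that by auto
  have "W = span (u ` {1..dim W})"
  proof (rule orthonormal_family_spans[OF W refl])
    fix k assume k: "k \<in> {1..dim W}"
    with pv eq show "u k \<in> W \<and> norm (u k) = 1"
      by (simp add: principal_vectors_def admissible_pair_def)
    fix j assume "j \<in> {1..dim W}" "j < k"
    with pv k show "u k \<bullet> u j = 0"
      by (auto simp: principal_vectors_def admissible_pair_def)
  qed
  note adm = admissible_pair_iff[of u v, OF this eq(1)]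
  have "dim W + 1 \<in> {1..dim W + 1}" by simp
  with pv show ?thesis
    unfolding principal_vectors_def adm by (metis friedrichs_cos_eqI adm)
qed

text \<open>
  An orthonormal basis of \<open>W\<close>, used for both families and followed by a pair realizing \<open>c\<close>, is a
  legitimate sequence of choices: without one the description of the principal angle would be void.
\<close>

lemma ex_principal_vectors: "\<exists>u v. principal_vectors U V (dim W + 1) u v"
proof -
  obtain B where B: "B \<subseteq> W" "pairwise orthogonal B" "\<And>x. x \<in> B \<Longrightarrow> norm x = 1"
    "independent B" "card B = dim W" "span B = W"
    using orthonormal_basis_subspace[OF W] by metis
  then have "finite B"
    using independent_imp_finite by blast
  then obtain f where f: "bij_betw f {1..dim W} B"
    using B(5) by (metis ex_bij_betw_nat_finite_1)
  obtain a b where ab: "a \<in> U'" "b \<in> V'" "norm a = 1" "norm b = 1" "c = a \<bullet> b"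
    by (rule friedrichs_pair)
  define u where "u = f(dim W + 1 := a)"
  define v where "v = f(dim W + 1 := b)"
  have f_eq: "u k = f k" "v k = f k" if "k \<in> {1..dim W}" for k
    using that by (auto simp: u_def v_def)
  have img: "u ` {1..dim W} = B"
    using f f_eq by (metis (no_types, lifting) bij_betw_def image_cong)
  then have adm: "admissible_pair U V u v (dim W + 1) x y \<longleftrightarrow>
      x \<in> U' \<and> y \<in> V' \<and> norm x = 1 \<and> norm y = 1" for x y
    using B f_eq by (intro admissible_pair_iff) auto
  have "admissible_pair U V u v k (u k) (v k) \<and>
      (\<forall>x y. admissible_pair U V u v k x y \<longrightarrow> x \<bullet> y \<le> u k \<bullet> v k)"
    if k: "k \<in> {1..dim W + 1}" for k
  proof (cases "k = dim W + 1")
    case True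
    show ?thesis
      using ab inner_le_c_unit unfolding True adm by (auto simp: u_def v_def)
  next
    case False
    then have k': "k \<in> {1..dim W}"
      using k by auto
    then have fk: "f k \<in> B"
      using f by (auto simp: bij_betw_def)
    then have n: "norm (f k) = 1" "f k \<in> W"
      using B by auto
    have "f k \<bullet> f j = 0" if "j \<in> {1..<k}" for j
    proof -
      have "f j \<in> B" "f j \<noteq> f k"
        using that f k' inj_onD[of f "{1..dim W}" j k] by (auto simp: bij_betw_def)
      then show ?thesis
        using B(2) fk by (auto simp: pairwise_def orthogonal_def)
    qed
    then show ?thesis
      using n k' f_eq unit_inner_le_1 by (auto simp: admissible_pair_def dot_square_norm)
  qed
  then show ?thesis
    unfolding principal_vectors_def by blast
qed

lemma principal_angle_eq: "principal_angle U V (dim W + 1) = arccos c"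
  unfolding principal_angle_def
proof (rule the_equality)
  obtain u v where uv: "principal_vectors U V (dim W + 1) u v"
    using ex_principal_vectors by blast
  show "0 \<le> arccos c \<and> arccos c \<le> pi / 2 \<and>
      (\<exists>u v. principal_vectors U V (dim W + 1) u v \<and> cos (arccos c) = u (dim W + 1) \<bullet> v (dim W + 1))"
    using uv principal_vectors_inner[OF uv] c_nonneg c_less_1
      arccos_lbound[of c] arccos_le_pi2[of c] cos_arccos[of c] by fastforce
next
  fix t assume "0 \<le> t \<and> t \<le> pi / 2 \<and>
      (\<exists>u v. principal_vectors U V (dim W + 1) u v \<and> cos t = u (dim W + 1) \<bullet> v (dim W + 1))"
  then show "t = arccos c"
    using arccos_cos[of t] principal_vectors_inner by auto
qed

end

section \<open>Eigenvalues and rates of convergence\<close>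

lemma matpow_mult_eigenvector:
  fixes A :: "'a::field^'n^'n"
  assumes "A *v x = z *s x"
  shows "matpow A k *v x = z ^ k *s x"
proof (induction k)
  case (Suc k)
  have "matpow A (Suc k) *v x = A *v (z ^ k *s x)"
    by (simp add: matrix_vector_mul_assoc[symmetric] Suc)
  also have "\<dots> = z ^ k *s (A *v x)"
    by (rule vector_scalar_commute)
  finally show ?case
    by (simp add: assms vector_smult_assoc mult.commute)
qed simp

lemma map_matrix_matpow:
  "map_matrix complex_of_real (matpow A k) = matpow (map_matrix complex_of_real A) k"
proof (induction k)
  case 0
  show ?case by (simp add: vec_eq_iff mat_def)
next
  case (Suc k)
  show ?case
    by (simp flip: Suc) (simp add: vec_eq_iff matrix_matrix_mult_def)
qed

lemma norm_le_opnorm: "norm (A *v x) \<le> opnorm A * norm x"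
  unfolding opnorm_def by (intro onorm matrix_vector_mul_bounded_linear)

lemma opnorm_nonneg: "0 \<le> opnorm A"
  unfolding opnorm_def by (intro onorm_pos_le matrix_vector_mul_bounded_linear)

text \<open>
  The operator norm only speaks of real vectors, whereas eigenvectors may be complex. Applying a real
  matrix to the real and imaginary parts separately costs the factor \<open>2\<close>, which no rate notices.
\<close>

lemma cmod_map_matrix_le:
  fixes x :: "complex^'n"
  shows "cmod ((map_matrix complex_of_real B *v x) $ i) \<le> 2 * opnorm B * norm x"
proof -
  let ?y = "map_matrix complex_of_real B *v x"
  have part: "norm (B *v (\<chi> j. f (x $ j))) \<le> opnorm B * norm x"
    if "\<And>z. \<bar>f z\<bar> \<le> cmod z" for f
  proof -
    have "norm (\<chi> j. f (x $ j)) \<le> norm x"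
      unfolding norm_vec_def by (rule L2_set_mono) (use that in auto)
    then show ?thesis
      using norm_le_opnorm[of B] opnorm_nonneg[of B] by (meson mult_left_mono order_trans)
  qed
  have "Re (?y $ i) = (B *v (\<chi> j. Re (x $ j))) $ i" "Im (?y $ i) = (B *v (\<chi> j. Im (x $ j))) $ i"
    by (simp_all add: matrix_vector_mult_def)
  then have "\<bar>Re (?y $ i)\<bar> \<le> opnorm B * norm x" "\<bar>Im (?y $ i)\<bar> \<le> opnorm B * norm x"
    using part[of Re] part[of Im] abs_Re_le_cmod abs_Im_le_cmod component_le_norm_cart
    by (metis order_trans)+
  then show ?thesis
    using cmod_le[of "?y $ i"] by linarith
qed

text \<open>
  At a nonzero coordinate of an eigenvector for \<open>z\<close>, the error \<open>A\<^sup>k - L\<close> shows up as a multiple of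
  \<open>z\<^sup>k - l\<close>, where \<open>l\<close> is determined by \<open>L\<close>. So the powers of \<open>z\<close> converge at least as fast as those of \<open>A\<close>.
\<close>

lemma spec_powers_converge:
  assumes "z \<in> spec A"
  obtains l e C where "e > 0" "\<And>k. e * cmod (z ^ k - l) \<le> C * opnorm (matpow A k - L)"
proof -
  let ?c = "map_matrix complex_of_real"
  obtain x where x: "x \<noteq> 0" and eig: "?c A *v x = z *s x"
    using assms by (auto simp: spec_def)
  then obtain i where i: "x $ i \<noteq> 0"
    by (auto simp: vec_eq_iff)
  define l where "l = (?c L *v x) $ i / x $ i"
  have "cmod (x $ i) * cmod (z ^ k - l) \<le> 2 * norm x * opnorm (matpow A k - L)" for k
  proof -
    have "?c (matpow A k - L) = ?c (matpow A k) - ?c L"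
      by (simp add: vec_eq_iff)
    then have "(?c (matpow A k - L) *v x) $ i = z ^ k * x $ i - (?c L *v x) $ i"
      using matpow_mult_eigenvector[OF eig, of k]
      by (simp add: map_matrix_matpow matrix_vector_mult_diff_rdistrib)
    also have "\<dots> = x $ i * (z ^ k - l)"
      using i by (simp add: l_def field_simps)
    finally show ?thesis
      using cmod_map_matrix_le[of "matpow A k - L" x i] by (simp add: norm_mult mult_ac)
  qed
  then show thesis
    using that[of "cmod (x $ i)" l "2 * norm x"] i by simp
qed

text \<open>A limit of \<open>z\<^sup>k\<close> is fixed under multiplication by \<open>z\<close>.\<close>

lemma powers_tendsto_imp:
  assumes lim: "(\<lambda>k. z ^ k) \<longlonglongrightarrow> l" and "z \<noteq> (1::complex)"
  shows "l = 0 \<and> cmod z < 1"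
proof -
  have "(\<lambda>k. z * z ^ k) \<longlonglongrightarrow> l"
    using LIMSEQ_Suc[OF lim] by simp
  moreover have "(\<lambda>k. z * z ^ k) \<longlonglongrightarrow> z * l"
    by (intro tendsto_intros lim)
  ultimately have "z * l = l"
    by (rule LIMSEQ_unique[rotated])
  then have "l = 0"
    using assms(2) by simp
  with lim have "(\<lambda>k. cmod z ^ k) \<longlonglongrightarrow> 0"
    using tendsto_norm_zero by (fastforce simp: norm_power)
  then have "eventually (\<lambda>k. cmod z ^ k < 1) sequentially"
    by (rule order_tendstoD) simp
  then obtain k where "cmod z ^ k < 1"
    by (auto simp: eventually_sequentially)
  then have "cmod z < 1"
    using one_le_power[of "cmod z" k] by linarith
  with \<open>l = 0\<close> show ?thesis by simp
qed

lemma spec_convergent: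
  assumes conv: "convergent_to A L" and z: "z \<in> spec A" "z \<noteq> 1"
  obtains e C where "e > 0" "\<And>k. e * cmod z ^ k \<le> C * opnorm (matpow A k - L)" "cmod z < 1"
proof -
  obtain l e C where e: "e > 0" and le: "\<And>k. e * cmod (z ^ k - l) \<le> C * opnorm (matpow A k - L)"
    using spec_powers_converge[OF z(1)] by metis
  have "(\<lambda>k. C * opnorm (matpow A k - L) / e) \<longlonglongrightarrow> 0"
    using conv e unfolding convergent_to_def by (auto intro!: tendsto_eq_intros)
  moreover have "cmod (z ^ k - l) \<le> C * opnorm (matpow A k - L) / e" for k
    using le[of k] e by (simp add: field_simps)
  ultimately have "(\<lambda>k. z ^ k - l) \<longlonglongrightarrow> 0"
    by (intro Lim_null_comparison[of "\<lambda>k. z ^ k - l"]) (auto simp: always_eventually)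
  then have "(\<lambda>k. z ^ k) \<longlonglongrightarrow> l"
    by (rule LIM_zero_cancel)
  with z have "l = 0" "cmod z < 1"
    using powers_tendsto_imp by auto
  with le e show thesis
    using that[of e C] by (simp add: norm_power)
qed

lemma rate_imp_convergent_to:
  assumes "convergent_with_rate A L r"
  shows "convergent_to A L"
proof -
  obtain M N where r: "0 \<le> r" "r < 1" and le: "\<And>k::nat. real k > N \<Longrightarrow> opnorm (matpow A k - L) \<le> M * r ^ k"
    using assms by (auto simp: convergent_with_rate_def)
  have "(\<lambda>k. M * r ^ k) \<longlonglongrightarrow> 0"
    using r by (intro tendsto_mult_right_zero LIMSEQ_power_zero) auto
  moreover have "eventually (\<lambda>k. norm (opnorm (matpow A k - L)) \<le> M * r ^ k) sequentially"
    using eventually_gt_at_top[of "nat \<lceil>N\<rceil>"]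
  proof eventually_elim
    case (elim k)
    then have "real k > N" by linarith
    from le[OF this] show ?case
      using opnorm_nonneg[of "matpow A k - L"] by simp
  qed
  ultimately show ?thesis
    unfolding convergent_to_def by (rule Lim_null_comparison[rotated])
qed

lemma geometric_le_imp_le:
  fixes a r :: real
  assumes "e > 0" "0 \<le> r" and le: "\<And>k::nat. real k > N \<Longrightarrow> e * a ^ k \<le> M * r ^ k"
  shows "a \<le> r"
proof (rule ccontr)
  assume "\<not> a \<le> r"
  then have a: "r < a" "0 < a"
    using assms by auto
  have "(\<lambda>k. M * (r / a) ^ k) \<longlonglongrightarrow> 0"
    using a assms by (intro tendsto_mult_right_zero LIMSEQ_power_zero) auto
  then have "eventually (\<lambda>k. M * (r / a) ^ k < e) sequentially"
    using \<open>e > 0\<close> by (rule order_tendstoD)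
  then have "eventually (\<lambda>k. False) sequentially"
    using eventually_gt_at_top[of "nat \<lceil>N\<rceil>"]
  proof eventually_elim
    case (elim k)
    then have "real k > N" by linarith
    from le[OF this] elim(1) a show False
      by (simp add: power_divide field_simps)
  qed
  then show False by simp
qed

lemma spec_le_rate:
  assumes rate: "convergent_with_rate A L r" and z: "z \<in> spec A" "z \<noteq> 1"
  shows "cmod z \<le> r"
proof -
  obtain M N where r: "0 \<le> r" and le: "\<And>k::nat. real k > N \<Longrightarrow> opnorm (matpow A k - L) \<le> M * r ^ k"
    using rate by (auto simp: convergent_with_rate_def)
  obtain e C where e: "e > 0" and C: "\<And>k. e * cmod z ^ k \<le> C * opnorm (matpow A k - L)"
    using spec_convergent[OF rate_imp_convergent_to[OF rate] z] by metis
  have "e * cmod z ^ k \<le> (\<bar>C\<bar> * M) * r ^ k" if "real k > N" for k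
  proof -
    have "C * opnorm (matpow A k - L) \<le> \<bar>C\<bar> * (M * r ^ k)"
      using le[OF that] opnorm_nonneg[of "matpow A k - L"] by (intro mult_mono) auto
    with C[of k] show ?thesis by simp
  qed
  with e r show ?thesis
    by (rule geometric_le_imp_le)
qed

lemma eigenvectors_inj:
  fixes A :: "'a::field^'n^'n"
  assumes eig: "\<And>z. z \<in> S \<Longrightarrow> x z \<noteq> 0 \<and> A *v x z = z *s x z"
  shows "inj_on x S"
proof (rule inj_onI)
  fix a b assume "a \<in> S" "b \<in> S" "x a = x b"
  then have "a *s x a = b *s x a" "x a \<noteq> 0"
    using eig by metis+
  then show "a = b" by simp
qed

text \<open>
  If an eigenvector for \<open>z\<close> were a combination of eigenvectors for other eigenvalues \<open>a\<close>, applying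
  \<open>A - z\<close> would multiply the coefficients by \<open>a - z \<noteq> 0\<close> and give zero.
\<close>

lemma eigenvectors_independent:
  fixes A :: "'a::field^'n^'n"
  assumes "finite S" and eig: "\<And>z. z \<in> S \<Longrightarrow> x z \<noteq> 0 \<and> A *v x z = z *s x z"
  shows "vec.independent (x ` S)"
  using assms
proof (induction S rule: finite_induct)
  case empty
  show ?case by (simp add: vec.independent_empty)
next
  case (insert z S)
  then have ind: "vec.independent (x ` S)" by simp
  have "inj_on x (insert z S)"
    using insert.prems by (rule eigenvectors_inj)
  then have inj: "inj_on x S" "x z \<notin> x ` S"
    using insert.hyps by (auto simp: inj_on_def)
  have "x z \<notin> vec.span (x ` S)"
  proof
    assume "x z \<in> vec.span (x ` S)"
    then obtain w where "x z = (\<Sum>v\<in>x ` S. w v *s v)"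
      using insert.hyps by (auto simp: vec.span_finite)
    then have xz: "x z = (\<Sum>a\<in>S. w (x a) *s x a)"
      by (simp add: sum.reindex[OF inj(1)])
    have "(\<Sum>a\<in>S. ((a - z) * w (x a)) *s x a) = (\<Sum>a\<in>S. w (x a) *s (A *v x a)) - z *s (\<Sum>a\<in>S. w (x a) *s x a)"
      using insert.prems by (simp add: vec.scale_sum_right sum_subtractf[symmetric] algebra_simps
        vec.scale_left_diff_distrib vector_smult_assoc)
    also have "(\<Sum>a\<in>S. w (x a) *s (A *v x a)) = A *v (\<Sum>a\<in>S. w (x a) *s x a)"
      by (simp add: vec.linear_sum[OF matrix_vector_mul_linear_gen] vector_scalar_commute)
    also have "\<dots> - z *s (\<Sum>a\<in>S. w (x a) *s x a) = 0"
      using insert.prems xz by (simp flip: xz)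
    \<comment> \<open>Independence of the set \<open>x ` S\<close> needs the coefficients as a function of the eigenvector.\<close>
    finally have 0: "(\<Sum>v\<in>x ` S. ((inv_into S x v - z) * w v) *s v) = 0"
      by (simp add: sum.reindex[OF inj(1)] inv_into_f_f[OF inj(1)])
    have "w (x a) = 0" if "a \<in> S" for a
    proof -
      have "(inv_into S x (x a) - z) * w (x a) = 0"
        using vec.independentD[OF ind _ subset_refl 0] that insert.hyps by blast
      moreover have "a \<noteq> z"
        using that insert.hyps by auto
      ultimately show ?thesis
        using that by (simp add: inv_into_f_f[OF inj(1)])
    qed
    then have "x z = 0"
      using xz by simp
    with insert.prems show False by simp
  qed
  with ind show ?case
    using inj(2) by (simp add: vec.independent_insert)
qed

text \<open>
  Finiteness is what gives \<open>gamma_mat\<close> its meaning, since it is defined with \<open>Max\<close>.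
\<close>

lemma finite_spec: "finite (spec A)"
proof (rule ccontr)
  assume "infinite (spec A)"
  then obtain S where S: "S \<subseteq> spec A" "finite S" "card S = Suc CARD('a)"
    by (metis infinite_arbitrarily_large)
  let ?A = "map_matrix complex_of_real A"
  have "\<forall>z\<in>S. \<exists>x. x \<noteq> 0 \<and> ?A *v x = z *s x"
    using S by (auto simp: spec_def)
  then obtain x where x: "\<And>z. z \<in> S \<Longrightarrow> x z \<noteq> 0 \<and> ?A *v x z = z *s x z"
    by metis
  have "inj_on x S"
    using x by (rule eigenvectors_inj)
  have "vec.independent (x ` S)"
    using S(2) x by (rule eigenvectors_independent)
  then have "card (x ` S) \<le> vec.dim (UNIV :: (complex^'a) set)"
    by (intro vec.independent_card_le_dim) auto
  with S \<open>inj_on x S\<close> show False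
    by (simp add: card_image vec_dim_card del: vec.dim_UNIV)
qed

lemma real_eigenvalue_in_spec:
  assumes "x \<noteq> 0" "A *v x = t *\<^sub>R x"
  shows "complex_of_real t \<in> spec A"
proof -
  let ?x = "\<chi> i. complex_of_real (x $ i)"
  have "map_matrix complex_of_real A *v ?x = (\<chi> i. complex_of_real ((A *v x) $ i))"
    by (simp add: vec_eq_iff matrix_vector_mult_def)
  also have "\<dots> = complex_of_real t *s ?x"
    using assms(2) by (simp add: vec_eq_iff)
  finally show ?thesis
    using assms(1) unfolding spec_def by (intro CollectI exI[of _ ?x]) (auto simp: vec_eq_iff)
qed

text \<open>
  A rate that is the modulus of an eigenvalue other than \<open>1\<close> meets the lower bound \<open>spec_le_rate\<close>
  and therefore is optimal and equal to \<open>\<gamma>\<close>.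
\<close>

lemma optimal_rate_gamma:
  assumes rate: "convergent_with_rate A L r"
    and z: "z \<in> spec A" "z \<noteq> 1" "cmod z = r"
  shows "optimal_rate A L r" "gamma_mat A = r"
proof -
  have "Inf {r'. convergent_with_rate A L r'} = r"
    using rate z spec_le_rate by (intro cInf_eq_minimum) auto
  with rate show "optimal_rate A L r"
    by (simp add: optimal_rate_def)
  show "gamma_mat A = r"
    unfolding gamma_mat_def
  proof (rule Max_eqI)
    show "finite (cmod ` ({0} \<union> spec A - {1}))"
      by (simp add: finite_spec)
    show "r \<in> cmod ` ({0} \<union> spec A - {1})"
      using z by auto
    show "y \<le> r" if "y \<in> cmod ` ({0} \<union> spec A - {1})" for y
      using that spec_le_rate[OF rate] rate by (auto simp: convergent_with_rate_def)
  qed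
qed

text \<open>
  In finite dimension it suffices to bound the error on each vector separately, as the operator norm
  is at most the sum of the errors on a basis. So each vector may be decomposed in its own way.
\<close>

lemma convergent_with_rate_pointwiseI:
  assumes r: "0 \<le> r" "r < 1"
    and le: "\<And>x. \<exists>M. \<forall>k. norm ((matpow A k - L) *v x) \<le> M * r ^ k"
  shows "convergent_with_rate A L r"
proof -
  obtain M where M: "\<And>x k. norm ((matpow A k - L) *v x) \<le> M x * r ^ k"
    using le by metis
  let ?M = "(\<Sum>i\<in>Basis. \<bar>M i\<bar>) + 1"
  have "opnorm (matpow A k - L) \<le> ?M * r ^ k" for k
  proof -
    have "opnorm (matpow A k - L) \<le> (\<Sum>i\<in>Basis. norm ((matpow A k - L) *v i))"
      unfolding opnorm_def by (rule onorm_componentwise) (rule matrix_vector_mul_bounded_linear)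
    also have "\<dots> \<le> (\<Sum>i\<in>Basis. \<bar>M i\<bar> * r ^ k)"
      using M r by (intro sum_mono) (meson abs_ge_self mult_right_mono order_trans zero_le_power)
    also have "\<dots> = (\<Sum>i\<in>Basis. \<bar>M i\<bar>) * r ^ k"
      by (simp add: sum_distrib_right)
    also have "\<dots> \<le> ?M * r ^ k"
      using r by (simp add: distrib_right)
    finally show ?thesis .
  qed
  moreover have "?M > 0"
    by (simp add: add_nonneg_pos sum_nonneg)
  ultimately show ?thesis
    using r unfolding convergent_with_rate_def by (intro conjI exI[of _ ?M] exI[of _ 1]) auto
qed

section \<open>Powers of the relaxed product of projections\<close>

context subspace_pair
begin

abbreviation "T \<equiv> relaxed_proj U V"

lemma T_mult: "T \<mu> *v x = (1 - \<mu>) *\<^sub>R x + \<mu> *\<^sub>R proj U (proj V x)"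
  by (simp add: relaxed_proj_def matrix_vector_mult_add_rdistrib scaleR_matrix_vector_assoc[symmetric]
      matrix_vector_mul_assoc[symmetric] proj_mat_mult U V)

lemma proj_V_in_V':
  assumes "x \<in> U'"
  shows "proj V x \<in> V'"
  using assms inner_proj[OF V] proj_in[OF V] by (auto simp: U'_def V'_def)

lemma proj_U_in_U':
  assumes "x \<in> V'"
  shows "proj U x \<in> U'"
  using assms inner_proj[OF U] proj_in[OF U] by (auto simp: U'_def V'_def)

text \<open>By \<open>\<parallel>P\<^sub>V x\<parallel>\<^sup>2 = \<langle>x, P\<^sub>V x\<rangle>\<close>, the vector \<open>P\<^sub>V x\<close> is itself a test vector for \<open>c\<close>.\<close>

lemma norm_proj_V_le:
  assumes x: "x \<in> U'"
  shows "norm (proj V x) \<le> c * norm x"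
proof (cases "proj V x = 0")
  case False
  have "(norm (proj V x))\<^sup>2 \<le> c * norm x * norm (proj V x)"
    using inner_le_c[OF x proj_V_in_V'[OF x]] by (simp add: inner_proj_self V)
  with False show ?thesis
    by (simp add: power2_eq_square)
qed (use c_nonneg in simp)

text \<open>
  For a pair \<open>u, v\<close> realizing \<open>c\<close>, the projection of \<open>u\<close> onto \<open>V\<close> has norm at most \<open>c\<close> and inner product
  \<open>c\<close> with the unit vector \<open>v\<close>, so it is \<open>c v\<close>. The same holds with the roles exchanged.
\<close>

lemma ex_eigenvector_c: "\<exists>u. u \<noteq> 0 \<and> proj U (proj V u) = c\<^sup>2 *\<^sub>R u"
proof -
  obtain u v where uv: "u \<in> U'" "v \<in> V'" "norm u = 1" "norm v = 1" "c = u \<bullet> v"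
    by (rule friedrichs_pair)
  have *: "proj Y x = c *\<^sub>R y"
    if Y: "subspace Y" and "norm (proj Y x) \<le> c" "y \<in> Y" "norm y = 1" "x \<bullet> y = c"
    for Y and x y :: "real^'n"
  proof -
    have "(proj Y x - c *\<^sub>R y) \<bullet> (proj Y x - c *\<^sub>R y) = (norm (proj Y x))\<^sup>2 - c\<^sup>2"
      unfolding inner_diff_left inner_diff_right
      using that inner_proj[OF Y \<open>y \<in> Y\<close>, of x]
      by (simp add: inner_commute[of y] dot_square_norm power2_eq_square)
    also have "\<dots> \<le> 0"
      using that by (simp add: power_mono)
    finally have "(proj Y x - c *\<^sub>R y) \<bullet> (proj Y x - c *\<^sub>R y) = 0"
      using inner_ge_zero[of "proj Y x - c *\<^sub>R y"] by linarith
    then show ?thesis by simp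
  qed
  have "proj V u = c *\<^sub>R v"
    using uv norm_proj_V_le[of u] by (intro * V) (auto simp: V'_def)
  moreover have "proj U v = c *\<^sub>R u"
  proof (intro * U)
    have "(norm (proj U v))\<^sup>2 \<le> c * norm (proj U v)"
      using inner_le_c[OF proj_U_in_U'[OF uv(2)] uv(2)] uv(4)
      by (simp add: inner_commute[of _ v] inner_proj_self U)
    then show "norm (proj U v) \<le> c"
      using c_nonneg by (cases "proj U v = 0") (auto simp: power2_eq_square)
  qed (use uv in \<open>auto simp: U'_def inner_commute\<close>)
  ultimately have "proj U (proj V u) = c\<^sup>2 *\<^sub>R u"
    by (simp add: linear_cmul[OF linear_proj[OF U]] power2_eq_square)
  then show ?thesis
    using uv by (intro exI[of _ u]) auto
qed

lemma c_eigenvalue: "complex_of_real (1 - \<mu> * (1 - c\<^sup>2)) \<in> spec (T \<mu>)"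
proof -
  obtain u where "u \<noteq> 0" "proj U (proj V u) = c\<^sup>2 *\<^sub>R u"
    using ex_eigenvector_c by blast
  then show ?thesis
    by (intro real_eigenvalue_in_spec[of u])
      (simp_all add: T_mult scaleR_left_distrib[symmetric] algebra_simps del: scaleR_left_diff_distrib)
qed

lemma kernel_eigenvalue:
  assumes "dim V < CARD('n)"
  shows "complex_of_real (1 - \<mu>) \<in> spec (T \<mu>)"
proof -
  obtain x :: "real^'n" where x: "norm x = 1" "\<And>t. t \<in> V \<Longrightarrow> x \<bullet> t = 0"
    using exists_unit_orthogonal[of UNIV V] assms by auto
  then have "proj V x = 0"
    by (intro proj_eq_0 V)
  then have "T \<mu> *v x = (1 - \<mu>) *\<^sub>R x"
    by (simp add: T_mult proj_eq_0 U)
  then show ?thesis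
    using x by (intro real_eigenvalue_in_spec[of x]) auto
qed

text \<open>
  This is the decomposition of the space into \<open>U\<close> and the kernel of \<open>P\<^sub>U P\<^sub>V\<close>: if \<open>y\<close> is as stated, \<open>x - y\<close>
  is in the kernel. The image \<open>S\<close> of \<open>U\<close> is already the whole image, because a vector \<open>e \<in> U\<close> orthogonal
  to \<open>S\<close> satisfies \<open>\<parallel>P\<^sub>V e\<parallel>\<^sup>2 = \<langle>e, P\<^sub>U P\<^sub>V e\<rangle> = 0\<close> and hence is orthogonal to every \<open>P\<^sub>U P\<^sub>V x\<close>.
\<close>

lemma ex_U_component: "\<exists>y\<in>U. proj U (proj V y) = proj U (proj V x)"
proof -
  define S where "S = (\<lambda>y. proj U (proj V y)) ` U"
  have S: "subspace S"
    unfolding S_def image_image[symmetric, of "proj U" "proj V"]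
    by (intro linear_subspace_image linear_proj U V)
  have SU: "S \<subseteq> U"
    using proj_in[OF U] by (auto simp: S_def)
  let ?z = "proj U (proj V x)"
  define e where "e = ?z - proj S ?z"
  have eU: "e \<in> U"
    using SU proj_in[OF S] proj_in[OF U] U by (auto simp: e_def intro!: subspace_diff)
  have eS: "e \<bullet> s = 0" if "s \<in> S" for s
    using inner_proj[OF S that] by (simp add: e_def inner_diff_left)
  have "e \<bullet> proj U (proj V e) = 0"
    using eU by (intro eS) (auto simp: S_def)
  then have "proj V e = 0"
    using eU by (simp add: proj_selfadjoint[OF U, symmetric] proj_ident[OF U] inner_proj_self[OF V])
  then have "e \<bullet> ?z = 0"
    using eU by (simp add: proj_selfadjoint[OF U, symmetric] proj_ident[OF U]
        proj_selfadjoint[OF V, symmetric])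
  then have "e \<bullet> e = 0"
    using eS[OF proj_in[OF S]] by (simp add: e_def[of] inner_diff_right)
  then have "?z \<in> S"
    using proj_in[OF S, of ?z] by (simp add: e_def)
  then show ?thesis
    by (auto simp: S_def)
qed

text \<open>The number \<open>\<rho>\<close> of the introduction, a bound for the norm of \<open>T \<mu>\<close> on \<open>U \<inter> W\<^sup>\<bottom>\<close> when \<open>\<mu> \<ge> 0\<close>.\<close>

definition "rate \<mu> = max (1 - \<mu> * (1 - c\<^sup>2)) (\<mu> - 1)"

lemma T_contraction:
  assumes \<mu>: "0 \<le> \<mu>" and x: "x \<in> U'"
  shows "T \<mu> *v x \<in> U'" "norm (T \<mu> *v x) \<le> rate \<mu> * norm x"
proof -
  have inv: "T \<mu> *v x \<in> U'" if "x \<in> U'" for x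
    unfolding T_mult using that
    by (intro subspace_add subspace_scale subspace_U' proj_U_in_U' proj_V_in_V')
  then show "T \<mu> *v x \<in> U'"
    using x by blast
  have PU: "proj U (proj V x) \<bullet> y = proj V x \<bullet> y" if "y \<in> U'" for x y
    using that by (intro inner_proj U) (simp add: U'_def)
  show "norm (T \<mu> *v x) \<le> rate \<mu> * norm x"
  proof (rule selfadjoint_norm_le[OF matrix_vector_mul_linear subspace_U' inv _ _ x])
    show "(T \<mu> *v x) \<bullet> y = x \<bullet> (T \<mu> *v y)" if "x \<in> U'" "y \<in> U'" for x y
      using that PU[of y x] PU[of x y] proj_selfadjoint[OF V, of x y]
      by (simp add: T_mult inner_add_left inner_add_right inner_commute)
  next
    fix x assume x: "x \<in> U'"
    let ?a = "(norm x)\<^sup>2" and ?b = "(norm (proj V x))\<^sup>2"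
    have form: "(T \<mu> *v x) \<bullet> x = (1 - \<mu>) * ?a + \<mu> * ?b"
      using inner_proj_self[OF V, of x]
      by (simp add: T_mult inner_add_left PU x inner_commute[of "proj V x"] dot_square_norm)
    have "?b \<le> c\<^sup>2 * ?a"
      using power_mono[OF norm_proj_V_le[OF x], of 2] by (simp add: power_mult_distrib)
    then have "\<mu> * ?b \<le> \<mu> * (c\<^sup>2 * ?a)"
      using \<mu> by (rule mult_left_mono)
    then have "(T \<mu> *v x) \<bullet> x \<le> (1 - \<mu> * (1 - c\<^sup>2)) * ?a"
      by (simp add: form algebra_simps)
    also have "\<dots> \<le> rate \<mu> * ?a"
      by (intro mult_right_mono) (auto simp: rate_def)
    finally have upper: "(T \<mu> *v x) \<bullet> x \<le> rate \<mu> * ?a" .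
    have "- ((T \<mu> *v x) \<bullet> x) \<le> (\<mu> - 1) * ?a"
      using \<mu> by (simp add: form algebra_simps)
    also have "\<dots> \<le> rate \<mu> * ?a"
      by (intro mult_right_mono) (auto simp: rate_def)
    finally show "\<bar>(T \<mu> *v x) \<bullet> x\<bar> \<le> rate \<mu> * ?a"
      using upper by simp
  qed
qed

lemma rate_ge:
  assumes "0 \<le> \<mu>"
  shows "\<bar>1 - \<mu>\<bar> \<le> rate \<mu>"
proof -
  have "0 \<le> \<mu> * c\<^sup>2"
    using assms by simp
  then have "1 - \<mu> \<le> 1 - \<mu> * (1 - c\<^sup>2)"
    by (simp add: algebra_simps)
  then show ?thesis
    unfolding rate_def by linarith
qed

lemma matpow_T_U':
  assumes \<mu>: "0 \<le> \<mu>" and x: "x \<in> U'"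
  shows "matpow (T \<mu>) k *v x \<in> U' \<and> norm (matpow (T \<mu>) k *v x) \<le> rate \<mu> ^ k * norm x"
proof (induction k)
  case 0
  show ?case using x by simp
next
  case (Suc k)
  let ?y = "matpow (T \<mu>) k *v x"
  have "norm (T \<mu> *v ?y) \<le> rate \<mu> * norm ?y" "T \<mu> *v ?y \<in> U'"
    using T_contraction[OF \<mu>] Suc by auto
  moreover have "rate \<mu> * norm ?y \<le> rate \<mu> * (rate \<mu> ^ k * norm x)"
    using Suc rate_ge[OF \<mu>] by (intro mult_left_mono) auto
  ultimately show ?case
    by (simp add: matrix_vector_mul_assoc[symmetric])
qed

text \<open>
  With \<open>y \<in> U\<close> as in \<open>ex_U_component\<close>, \<open>z = x - y\<close> and \<open>w = P\<^sub>W y\<close>, split \<open>x = w + (y - w) + z\<close>. The powers of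
  \<open>T \<mu>\<close> fix \<open>w\<close>, shrink \<open>y - w \<in> U \<inter> W\<^sup>\<bottom>\<close> like \<open>\<rho>\<^sup>k\<close> and multiply \<open>z\<close> by \<open>(1 - \<mu>)\<^sup>k\<close>, where \<open>\<bar>1 - \<mu>\<bar> \<le> \<rho>\<close>.
\<close>

lemma T_convergent_with_rate:
  assumes \<mu>: "0 \<le> \<mu>" and "rate \<mu> < 1"
  shows "convergent_with_rate (T \<mu>) (proj_mat W) (rate \<mu>)"
proof (rule convergent_with_rate_pointwiseI)
  show nonneg: "0 \<le> rate \<mu>"
    using rate_ge[OF \<mu>] by simp
  fix x
  obtain y where y: "y \<in> U" "proj U (proj V y) = proj U (proj V x)"
    using ex_U_component by blast
  define z where "z = x - y"
  define w where "w = proj W y"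
  have z: "proj U (proj V z) = 0"
    by (simp add: z_def y linear_diff[OF linear_proj[OF U]] linear_diff[OF linear_proj[OF V]])
  have w: "w \<in> W"
    using proj_in[OF W] by (simp add: w_def)
  have yw: "y - w \<in> U'"
    using y w U inner_proj[OF W] by (simp add: U'_def w_def subspace_diff inner_diff_left)
  \<comment> \<open>The kernel of \<open>P\<^sub>U P\<^sub>V\<close> is orthogonal to \<open>W\<close>, as the adjoint \<open>P\<^sub>V P\<^sub>U\<close> fixes \<open>W\<close>.\<close>
  have "z \<bullet> t = 0" if "t \<in> W" for t
    using proj_selfadjoint[OF U, of "proj V z" t] proj_selfadjoint[OF V, of z t] that z
    by (simp add: proj_ident U V)
  then have "proj W z = 0"
    by (intro proj_eq_0 W)
  then have Px: "proj W x = w"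
    using linear_add[OF linear_proj[OF W], of y z] by (simp add: z_def w_def)
  have Tw: "matpow (T \<mu>) k *v w = w" for k
    using matpow_mult_eigenvector[of "T \<mu>" w 1 k] w
    by (simp add: T_mult proj_ident U V scaleR_left_distrib[symmetric])
  have Tz: "matpow (T \<mu>) k *v z = (1 - \<mu>) ^ k *\<^sub>R z" for k
    using matpow_mult_eigenvector[of "T \<mu>" z "1 - \<mu>" k]
    by (simp add: T_mult z scalar_mult_eq_scaleR)
  have "norm ((matpow (T \<mu>) k - proj_mat W) *v x) \<le> (norm (y - w) + norm z) * rate \<mu> ^ k" for k
  proof -
    have "x = w + (y - w) + z"
      by (simp add: z_def)
    then have "matpow (T \<mu>) k *v x = w + matpow (T \<mu>) k *v (y - w) + (1 - \<mu>) ^ k *\<^sub>R z"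
      using Tw Tz by (metis matrix_vector_right_distrib)
    then have "(matpow (T \<mu>) k - proj_mat W) *v x = matpow (T \<mu>) k *v (y - w) + (1 - \<mu>) ^ k *\<^sub>R z"
      by (simp add: matrix_vector_mult_diff_rdistrib proj_mat_mult W Px)
    moreover have "norm (matpow (T \<mu>) k *v (y - w)) \<le> norm (y - w) * rate \<mu> ^ k"
      using matpow_T_U'[OF \<mu> yw] by (simp add: mult.commute)
    moreover have "norm ((1 - \<mu>) ^ k *\<^sub>R z) \<le> norm z * rate \<mu> ^ k"
      using power_mono[OF rate_ge[OF \<mu>], of k]
      by (simp add: power_abs mult.commute mult_left_mono)
    ultimately show ?thesis
      using norm_triangle_ineq[of "matpow (T \<mu>) k *v (y - w)" "(1 - \<mu>) ^ k *\<^sub>R z"]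
      by (simp add: distrib_right)
  qed
  then show "\<exists>M. \<forall>k. norm ((matpow (T \<mu>) k - proj_mat W) *v x) \<le> M * rate \<mu> ^ k"
    by blast
qed fact

section \<open>The optimal rate as a function of the relaxation parameter\<close>

lemma c_sq: "0 \<le> c\<^sup>2" "c\<^sup>2 < 1"
  using c_nonneg c_less_1 by (simp_all add: power_less_one_iff abs_square_less_1)

lemma rate_less_1: "0 < \<mu> \<Longrightarrow> \<mu> < 2 \<Longrightarrow> rate \<mu> < 1"
  using c_sq by (simp add: rate_def)

lemma rate_eq_left:
  assumes "\<mu> \<le> 2 / (1 + (1 - c\<^sup>2))"
  shows "rate \<mu> = 1 - \<mu> * (1 - c\<^sup>2)"
proof -
  have "\<mu> * (1 + (1 - c\<^sup>2)) \<le> 2"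
    using assms c_sq by (simp add: pos_le_divide_eq)
  then show ?thesis
    by (simp add: rate_def algebra_simps)
qed

lemma rate_eq_right:
  assumes "2 / (1 + (1 - c\<^sup>2)) \<le> \<mu>"
  shows "rate \<mu> = \<mu> - 1"
proof -
  have "2 \<le> \<mu> * (1 + (1 - c\<^sup>2))"
    using assms c_sq by (simp add: pos_divide_le_eq)
  then show ?thesis
    by (simp add: rate_def algebra_simps)
qed

lemma rate_ge_minimum: "c\<^sup>2 / (1 + (1 - c\<^sup>2)) \<le> rate \<mu>"
proof (cases "\<mu> \<le> 2 / (1 + (1 - c\<^sup>2))")
  case True
  have "\<mu> * (1 - c\<^sup>2) \<le> 2 / (1 + (1 - c\<^sup>2)) * (1 - c\<^sup>2)"
    using True c_sq by (intro mult_right_mono) auto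
  also have "\<dots> = 1 - c\<^sup>2 / (1 + (1 - c\<^sup>2))"
    using c_sq by (simp add: field_simps)
  finally show ?thesis
    using True by (simp add: rate_eq_left)
next
  case False
  have "2 / (1 + (1 - c\<^sup>2)) - 1 = c\<^sup>2 / (1 + (1 - c\<^sup>2))"
    using c_sq by (simp add: field_simps)
  with False show ?thesis
    by (simp add: rate_eq_right)
qed

lemma rate_minimum: "rate (2 / (1 + (1 - c\<^sup>2))) = c\<^sup>2 / (1 + (1 - c\<^sup>2))"
  using c_sq by (subst rate_eq_right) (auto simp: field_simps)

lemma rate_less_c_sq_iff: "rate \<mu> < c\<^sup>2 \<longleftrightarrow> \<mu> \<in> {1<..<2 - (1 - c\<^sup>2)}"
proof -
  have "1 - \<mu> * (1 - c\<^sup>2) < c\<^sup>2 \<longleftrightarrow> 1 * (1 - c\<^sup>2) < \<mu> * (1 - c\<^sup>2)"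
    by (simp add: algebra_simps)
  also have "\<dots> \<longleftrightarrow> 1 < \<mu>"
    using c_sq by (intro mult_less_cancel_right_pos) simp
  finally show ?thesis
    by (auto simp: rate_def)
qed

lemma optimal_rate_T:
  assumes "dim V < CARD('n)" "0 < \<mu>" "\<mu> < 2"
  shows "optimal_rate (T \<mu>) (proj_mat W) (rate \<mu>)" "gamma_mat (T \<mu>) = rate \<mu>"
proof -
  have conv: "convergent_with_rate (T \<mu>) (proj_mat W) (rate \<mu>)"
    using assms rate_less_1 by (intro T_convergent_with_rate) auto
  then have nonneg: "0 \<le> rate \<mu>"
    by (simp add: convergent_with_rate_def)
  obtain t where "complex_of_real t \<in> spec (T \<mu>)" "t \<noteq> 1" "\<bar>t\<bar> = rate \<mu>"
  proof (cases "1 - \<mu> * (1 - c\<^sup>2) \<ge> \<mu> - 1")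
    case True
    with nonneg show thesis
      using that[of "1 - \<mu> * (1 - c\<^sup>2)"] c_eigenvalue c_sq assms True by (auto simp: rate_def)
  next
    case False
    with nonneg show thesis
      using that[of "1 - \<mu>"] kernel_eigenvalue[OF assms(1)] assms False by (auto simp: rate_def)
  qed
  then show "optimal_rate (T \<mu>) (proj_mat W) (rate \<mu>)" "gamma_mat (T \<mu>) = rate \<mu>"
    using optimal_rate_gamma[OF conv, of "complex_of_real t"] by auto
qed

lemma convergent_T_imp:
  assumes "dim V < CARD('n)" "convergent_to (T \<mu>) L" "\<mu> \<noteq> 0"
  shows "0 < \<mu>" "\<mu> < 2"
proof -
  have "cmod (complex_of_real (1 - \<mu>)) < 1"
    by (rule spec_convergent[OF assms(2) kernel_eigenvalue[OF assms(1)]])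
      (use assms(3) in \<open>simp_all del: of_real_diff\<close>)
  then show "0 < \<mu>" "\<mu> < 2"
    unfolding norm_of_real by linarith+
qed

lemma rate_le:
  assumes V: "dim V < CARD('n)" and conv: "convergent_with_rate (T \<mu>) L r" and "\<mu> \<noteq> 0"
  shows "0 < \<mu>" "\<mu> < 2" "rate \<mu> \<le> r"
proof -
  show \<mu>: "0 < \<mu>" "\<mu> < 2"
    using convergent_T_imp[OF V rate_imp_convergent_to[OF conv] \<open>\<mu> \<noteq> 0\<close>] .
  have "t \<noteq> 1 \<Longrightarrow> complex_of_real t \<in> spec (T \<mu>) \<Longrightarrow> \<bar>t\<bar> \<le> r" for t
    using spec_le_rate[OF conv, of "complex_of_real t"] by simp
  from this[OF _ c_eigenvalue] this[OF _ kernel_eigenvalue[OF V]]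
  show "rate \<mu> \<le> r"
    using \<mu> c_sq by (simp add: rate_def abs_le_iff)
qed

lemma convergent_T_0: "convergent_to (T 0) (mat 1)"
proof -
  have "matpow (mat 1 :: real^'n^'n) k = mat 1" for k
    by (induction k) simp_all
  moreover have "(*v) (0 :: real^'n^'n) = (\<lambda>x. 0)"
    by auto
  ultimately show ?thesis
    by (simp add: convergent_to_def relaxed_proj_def opnorm_def onorm_zero)
qed

end

theorem theorem3p6:
  fixes U V :: "(real^'n) set" and p q s :: nat and \<theta> :: real and T :: "real \<Rightarrow> real^'n^'n"
  assumes "subspace U" and "subspace V"
    and "p = dim U" and "q = dim V"
    and "1 \<le> p" and "p \<le> q" and "q \<le> CARD('n) - 1"
    and "s = dim (U \<inter> V)" and "s < p"
    and "\<theta> = principal_angle U V (s + 1)"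
    and "T = relaxed_proj U V"
  shows "\<theta> = friedrichs_angle U V
    \<and> (\<forall>\<mu>. convergent_mat (T \<mu>) \<longleftrightarrow> \<mu> \<in> {0..<2})
    \<and> (\<forall>\<mu> \<in> {0<..2 / (1 + (sin \<theta>)\<^sup>2)}.
          convergent_to (T \<mu>) (proj_mat (U \<inter> V))
          \<and> optimal_rate (T \<mu>) (proj_mat (U \<inter> V)) (gamma_mat (T \<mu>))
          \<and> gamma_mat (T \<mu>) = 1 - \<mu> * (sin \<theta>)\<^sup>2)
    \<and> (\<forall>\<mu> \<in> {2 / (1 + (sin \<theta>)\<^sup>2)<..<2}.
          convergent_to (T \<mu>) (proj_mat (U \<inter> V))
          \<and> optimal_rate (T \<mu>) (proj_mat (U \<inter> V)) (gamma_mat (T \<mu>))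
          \<and> gamma_mat (T \<mu>) = \<mu> - 1)
    \<and> (\<forall>\<mu>. \<mu> \<noteq> 0 \<longrightarrow>
          ((\<exists>r. r < (cos \<theta>)\<^sup>2 \<and> convergent_with_rate (T \<mu>) (proj_mat (U \<inter> V)) r)
            \<longleftrightarrow> \<mu> \<in> {1<..<2 - (sin \<theta>)\<^sup>2}))
    \<and> optimal_rate (T (2 / (1 + (sin \<theta>)\<^sup>2))) (proj_mat (U \<inter> V))
        ((1 - (sin \<theta>)\<^sup>2) / (1 + (sin \<theta>)\<^sup>2))
    \<and> (\<forall>\<mu> L r. \<mu> \<noteq> 0 \<longrightarrow> convergent_with_rate (T \<mu>) L r
          \<longrightarrow> (1 - (sin \<theta>)\<^sup>2) / (1 + (sin \<theta>)\<^sup>2) \<le> r)"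
proof -
  interpret subspace_pair U V
    using assms by unfold_locales auto
  have V_proper: "dim V < CARD('n)"
    using assms by linarith
  have \<theta>: "\<theta> = arccos c"
    using assms principal_angle_eq by simp
  then have cos: "cos \<theta> = c"
    using c_nonneg c_less_1 by simp
  then have sin: "(sin \<theta>)\<^sup>2 = 1 - c\<^sup>2"
    by (simp add: sin_squared_eq)
  have T: "T = relaxed_proj U V"
    by fact
  have bound: "0 < 2 / (1 + (1 - c\<^sup>2))" "2 / (1 + (1 - c\<^sup>2)) < 2"
    using c_sq by (auto simp: field_simps)
  have opt: "convergent_to (T \<mu>) (proj_mat W)" "optimal_rate (T \<mu>) (proj_mat W) (rate \<mu>)"
      "gamma_mat (T \<mu>) = rate \<mu>" if "0 < \<mu>" "\<mu> < 2" for \<mu>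
    using optimal_rate_T[OF V_proper that] rate_imp_convergent_to
    by (auto simp: T optimal_rate_def)
  have "convergent_mat (T \<mu>) \<longleftrightarrow> \<mu> \<in> {0..<2}" for \<mu>
  proof (cases "\<mu> = 0")
    case True
    then show ?thesis
      using convergent_T_0 by (auto simp: convergent_mat_def T)
  next
    case False
    then have "0 < \<mu> \<and> \<mu> < 2" if "convergent_mat (T \<mu>)"
      using that convergent_T_imp[OF V_proper] unfolding convergent_mat_def T by blast
    moreover have "convergent_mat (T \<mu>)" if "0 < \<mu>" "\<mu> < 2"
      using opt(1)[OF that] unfolding convergent_mat_def by blast
    ultimately show ?thesis
      using False by auto
  qed
  moreover have "(\<exists>r. r < c\<^sup>2 \<and> convergent_with_rate (T \<mu>) (proj_mat W) r) \<longleftrightarrow>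
      \<mu> \<in> {1<..<2 - (1 - c\<^sup>2)}" if "\<mu> \<noteq> 0" for \<mu>
  proof
    assume "\<exists>r. r < c\<^sup>2 \<and> convergent_with_rate (T \<mu>) (proj_mat W) r"
    then have "rate \<mu> < c\<^sup>2"
      using rate_le(3)[OF V_proper _ that] unfolding T by (meson order_le_less_trans)
    then show "\<mu> \<in> {1<..<2 - (1 - c\<^sup>2)}"
      by (simp only: rate_less_c_sq_iff)
  next
    assume \<mu>: "\<mu> \<in> {1<..<2 - (1 - c\<^sup>2)}"
    then have "rate \<mu> < c\<^sup>2"
      by (simp only: rate_less_c_sq_iff)
    moreover have "convergent_with_rate (T \<mu>) (proj_mat W) (rate \<mu>)"
      using \<mu> opt(2)[of \<mu>] c_sq by (auto simp: optimal_rate_def)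
    ultimately show "\<exists>r. r < c\<^sup>2 \<and> convergent_with_rate (T \<mu>) (proj_mat W) r"
      by blast
  qed
  moreover have "c\<^sup>2 / (1 + (1 - c\<^sup>2)) \<le> r" if "\<mu> \<noteq> 0" "convergent_with_rate (T \<mu>) L r" for \<mu> L r
    using rate_le(3)[OF V_proper _ that(1)] that(2) rate_ge_minimum[of \<mu>] unfolding T
    by (meson order_trans)
  moreover have "optimal_rate (T (2 / (1 + (1 - c\<^sup>2)))) (proj_mat W) (c\<^sup>2 / (1 + (1 - c\<^sup>2)))"
    using opt(2)[OF bound] by (simp only: rate_minimum)
  moreover have "convergent_to (T \<mu>) (proj_mat W)
      \<and> optimal_rate (T \<mu>) (proj_mat W) (gamma_mat (T \<mu>))
      \<and> gamma_mat (T \<mu>) = 1 - \<mu> * (1 - c\<^sup>2)" if "\<mu> \<in> {0<..2 / (1 + (1 - c\<^sup>2))}" for \<mu>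
  proof -
    have "0 < \<mu>" "\<mu> < 2" "rate \<mu> = 1 - \<mu> * (1 - c\<^sup>2)"
      using that bound rate_eq_left by auto
    with opt[of \<mu>] show ?thesis by simp
  qed
  moreover have "convergent_to (T \<mu>) (proj_mat W)
      \<and> optimal_rate (T \<mu>) (proj_mat W) (gamma_mat (T \<mu>))
      \<and> gamma_mat (T \<mu>) = \<mu> - 1" if "\<mu> \<in> {2 / (1 + (1 - c\<^sup>2))<..<2}" for \<mu>
  proof -
    have "0 < \<mu>" "\<mu> < 2" "rate \<mu> = \<mu> - 1"
      using that less_trans[OF bound(1)] rate_eq_right[of \<mu>] by simp_all
    with opt[of \<mu>] show ?thesis by simp
  qed
  moreover have "\<theta> = friedrichs_angle U V"
    using \<theta> friedrichs_angle_eq by simp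
  moreover have c2: "1 - (1 - c\<^sup>2) = c\<^sup>2"
    by simp
  ultimately show ?thesis
    unfolding cos sin c2 by blast
qed

end
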